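(* Let $(X,\mathcal{T})$ be a topological space and $\mathcal{B}$ a basis for $\mathcal{T}$ closed under finite unions, with $X\in\mathcal{B}$. Let $i$ be an initial interpretation and let $\mathcal{M}_1=\langle X,\mathcal{T},i\rangle$ and $\mathcal{M}_2=\langle X,\mathcal{B},i\rangle$ be the corresponding models. Then for all $\phi\in\mathcal{L}$, $$\mathcal{M}_1\models\phi\iff\mathcal{M}_2\models\phi.$$
   Context: Language: $\mathsf{A}$ is a countable set of atomic formulae with two distinguished elements $\top,\bot$. $\mathcal{L}$ is the least set containing $\mathsf{A}$ and closed under $\phi\land\psi$, $\neg\phi$, $\Box\phi$, $\mathsf{K}\phi$. Models: a subset space is a pair $\langle X,\mathcal{O}\rangle$ with $\mathcal{O}\subseteq\mathcal{P}(X)$ and $X\in\mathcal{O}$. A model is $\langle X,\mathcal{O},i\rangle$ with $\langle X,\mathcal{O}\rangle$ a subset space and $i:\mathsf{A}\to\mathcal{P}(X)$ (the initial interpretation) with $i(\top)=X$, $i(\bot)=\emptyset$. Satisfaction in a model $\mathcal{M}=\langle X,\mathcal{O},i\rangle$ is defined for pairs $(x,U)$ with $x\in U\in\mathcal{O}$: $x,U\models A$ iff $x\in i(A)$ for atomic $A$; Boolean connectives as usual; $x,U\models\mathsf{K}\phi$ iff $y,U\models\phi$ for all $y\in U$; $x,U\models\Box\phi$ iff $x,V\models\phi$ for all $V\in\mathcal{O}$ with $x\in V\subseteq U$. $\mathcal{M}\models\phi$ ($\phi$ is valid in $\mathcal{M}$) means $x,U\models\phi$ for all $(x,U)$ with $x\in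 U\in\mathcal{O}$. *)

theory Defs
  imports "HOL-Analysis.Analysis"
begin

text \<open>The countable set of atoms is rendered as a type \<open>'p\<close> of class \<open>countable\<close>; its two
  distinguished elements are parameters \<open>tt\<close> and \<open>ff\<close> wherever they matter.\<close>

datatype 'p fm =
    Atom 'p
  | And "'p fm" "'p fm"
  | Neg "'p fm"
  | Box "'p fm"
  | Know "'p fm"

record ('x, 'p) model =
  points :: "'x set"
  opens  :: "'x set set"
  interp :: "'p \<Rightarrow> 'x set"

definition initial_interpretation :: "'p \<Rightarrow> 'p \<Rightarrow> 'x set \<Rightarrow> ('p \<Rightarrow> 'x set) \<Rightarrow> bool" where
  "initial_interpretation tt ff X i \<longleftrightarrow> (\<forall>a. i a \<subseteq> X) \<and> i tt = X \<and> i ff = {}"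

text \<open>Satisfaction is meaningful only for \<open>x \<in> U \<in> opens M\<close>. The recursive calls, and the
  definition of validity, only ever reach such pairs.\<close>

primrec sat :: "('x, 'p) model \<Rightarrow> 'x \<Rightarrow> 'x set \<Rightarrow> 'p fm \<Rightarrow> bool" where
  "sat M x U (Atom a) \<longleftrightarrow> x \<in> interp M a"
| "sat M x U (And \<phi> \<psi>) \<longleftrightarrow> sat M x U \<phi> \<and> sat M x U \<psi>"
| "sat M x U (Neg \<phi>) \<longleftrightarrow> \<not> sat M x U \<phi>"
| "sat M x U (Box \<phi>) \<longleftrightarrow> (\<forall>V \<in> opens M. x \<in> V \<and> V \<subseteq> U \<longrightarrow> sat M x V \<phi>)"
| "sat M x U (Know \<phi>) \<longleftrightarrow> (\<forall>y \<in> U. sat M y U \<phi>)"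

definition valid_in :: "('x, 'p) model \<Rightarrow> 'p fm \<Rightarrow> bool" where
  "valid_in M \<phi> \<longleftrightarrow> (\<forall>U \<in> opens M. \<forall>x \<in> U. sat M x U \<phi>)"

definition basis_of :: "'x topology \<Rightarrow> 'x set set \<Rightarrow> bool" where
  "basis_of T B \<longleftrightarrow> openin T = arbitrary union_of (\<lambda>U. U \<in> B)"

text \<open>The empty union is excluded, so \<open>{}\<close> need not belong to \<open>B\<close>.\<close>

definition closed_under_finite_unions :: "'x set set \<Rightarrow> bool" where
  "closed_under_finite_unions B \<longleftrightarrow> (\<forall>F \<subseteq> B. finite F \<and> F \<noteq> {} \<longrightarrow> \<Union>F \<in> B)"

end

(* For each formula phi there is a finite set D of open sets such that, in the model of all open
   sets, the truth of phi at (x,U) depends only on x and on which members of D contain U.  That U is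
   not contained in finitely many members of D is witnessed by finitely many points of U, so some
   basic V with x in V, V a subset of U, is contained in the same members of D and agrees with U on phi. *)

theory Submission
  imports Defs
begin

definition decides :: "('x, 'p) model \<Rightarrow> 'x set set \<Rightarrow> 'p fm \<Rightarrow> bool" where
  "decides M D \<phi> \<longleftrightarrow> (\<forall>U \<in> opens M. \<forall>V \<in> opens M. \<forall>x \<in> U \<inter> V.
     (\<forall>S \<in> D. U \<subseteq> S \<longleftrightarrow> V \<subseteq> S) \<longrightarrow> (sat M x U \<phi> \<longleftrightarrow> sat M x V \<phi>))"

text \<open>The conditions on \<open>U\<close> and \<open>V\<close> are symmetric, so one
  implication suffices.\<close>

lemma decidesI:
  assumes "\<And>U V x. \<lbrakk>U \<in> opens M; V \<in> opens M; x \<in> U; x \<in> V; \<forall>S \<in> D. U \<subseteq> S \<longleftrightarrow> V \<subseteq> S; sat M x U \<phi>\<rbrakk>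
    \<Longrightarrow> sat M x V \<phi>"
  shows "decides M D \<phi>"
  unfolding decides_def
proof (intro ballI impI)
  fix U V x assume *: "U \<in> opens M" "V \<in> opens M" "x \<in> U \<inter> V" "\<forall>S \<in> D. U \<subseteq> S \<longleftrightarrow> V \<subseteq> S"
  show "sat M x U \<phi> \<longleftrightarrow> sat M x V \<phi>"
    using assms[of U V x] assms[of V U x] * by blast
qed

lemma decidesD:
  assumes "decides M D \<phi>" "U \<in> opens M" "V \<in> opens M" "x \<in> U" "x \<in> V"
    and "\<And>S. S \<in> D \<Longrightarrow> U \<subseteq> S \<longleftrightarrow> V \<subseteq> S"
  shows "sat M x U \<phi> \<longleftrightarrow> sat M x V \<phi>"
  using assms unfolding decides_def by blast

text \<open>For an open set \<open>U\<close> contained in exactly the members \<open>C\<close> of \<open>D\<close>, the formula \<open>Know \<phi>\<close> holds at \<open>U\<close> iff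
  \<open>U\<close> is contained in the set \<open>W C\<close> of points satisfying \<open>\<phi>\<close> in some such open set.\<close>

lemma decides_Know:
  assumes M: "opens M = {U. openin T U}" and D: "decides M D \<phi>"
  defines "W \<equiv> \<lambda>C. {y. \<exists>U. openin T U \<and> y \<in> U \<and> {S \<in> D. U \<subseteq> S} = C \<and> sat M y U \<phi>}"
  shows "decides M (D \<union> (\<lambda>C. T interior_of W C) ` Pow D) (Know \<phi>)"
proof (rule decidesI)
  fix U V x
  assume U: "U \<in> opens M" and V: "V \<in> opens M" and sat: "sat M x U (Know \<phi>)"
    and eq: "\<forall>S \<in> D \<union> (\<lambda>C. T interior_of W C) ` Pow D. U \<subseteq> S \<longleftrightarrow> V \<subseteq> S"
  let ?C = "{S \<in> D. U \<subseteq> S}"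
  have oU: "openin T U" and oV: "openin T V" using U V M by auto
  have CV: "{S \<in> D. V \<subseteq> S} = ?C" using eq by auto
  have "U \<subseteq> W ?C" using sat oU unfolding W_def by auto
  \<comment> \<open>\<open>W ?C\<close> need not be open, but an open set lies in it iff it lies in
    its interior. Passing to the interior keeps the deciding family open.\<close>
  then have "U \<subseteq> T interior_of W ?C" using oU by (simp add: interior_of_maximal)
  moreover have "?C \<in> Pow D" by auto
  ultimately have "V \<subseteq> T interior_of W ?C" using eq by blast
  then have VW: "V \<subseteq> W ?C" using interior_of_subset by (rule subset_trans)
  show "sat M x V (Know \<phi>)"
    unfolding sat.simps
  proof
    fix y assume y: "y \<in> V"
    \<comment> \<open>\<open>U'\<close> varies with \<open>y\<close> and need not be comparable with
      \<open>V\<close>; sharing the point \<open>y\<close> and the pattern \<open>?C\<close> is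
      enough to transfer \<open>\<phi>\<close>.\<close>
    then obtain U' where U': "openin T U'" "y \<in> U'" "{S \<in> D. U' \<subseteq> S} = ?C" "sat M y U' \<phi>"
      using VW unfolding W_def by blast
    have "U' \<subseteq> S \<longleftrightarrow> V \<subseteq> S" if "S \<in> D" for S
      using U'(3) CV that by blast
    then show "sat M y V \<phi>" using decidesD[OF D, of U' V y] U' V y M by simp
  qed
qed

text \<open>If \<open>V' \<subseteq> V\<close> is contained in exactly the members \<open>C\<close> of \<open>D\<close>, then \<open>U \<inter> \<Inter>C\<close> is the candidate
  for its counterpart below \<open>U\<close>; the added sets decide whether it is contained in any further
  member of \<open>D\<close>.\<close>

lemma decides_Box:
  assumes M: "opens M = {U. openin T U}" and D: "decides M D \<phi>"
    and fin: "finite D" and op: "\<forall>S \<in> D. openin T S"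
  shows "decides M (D \<union> (\<lambda>(S, C). T interior_of (S \<union> - \<Inter>C)) ` (D \<times> Pow D)) (Box \<phi>)"
    (is "decides M ?D _")
proof (rule decidesI)
  fix U V x
  assume U: "U \<in> opens M" and V: "V \<in> opens M" and x: "x \<in> U" "x \<in> V"
    and eq: "\<forall>S \<in> ?D. U \<subseteq> S \<longleftrightarrow> V \<subseteq> S" and sat: "sat M x U (Box \<phi>)"
  have oU: "openin T U" and oV: "openin T V" using U V M by auto
  show "sat M x V (Box \<phi>)"
    unfolding sat.simps
  proof (intro ballI impI)
    fix V' assume V': "V' \<in> opens M" and xV': "x \<in> V' \<and> V' \<subseteq> V"
    define C where "C = {S \<in> D. V' \<subseteq> S}"
    define U' where "U' = U \<inter> \<Inter>C"
    have "openin T U'"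
    \<comment> \<open>For empty \<open>C\<close> the intersection is the whole type, which need not
      be open in \<open>T\<close>; then \<open>U'\<close> is just \<open>U\<close>. Otherwise
      finiteness of \<open>D\<close> makes \<open>\<Inter>C\<close> open.\<close>
    proof (cases "C = {}")
      case False
      then have "openin T (\<Inter>C)" using fin op by (intro openin_Inter) (auto simp: C_def)
      then show ?thesis using oU by (simp add: U'_def openin_Int)
    qed (use oU in \<open>simp add: U'_def\<close>)
    then have oU': "U' \<in> opens M" using M by simp
    have xU': "x \<in> U'" using x xV' by (auto simp: U'_def C_def)
    have "U' \<subseteq> S \<longleftrightarrow> V' \<subseteq> S" if S: "S \<in> D" for S
    proof
      assume "V' \<subseteq> S"
      then show "U' \<subseteq> S" using S by (auto simp: U'_def C_def)
    next
      assume "U' \<subseteq> S"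
      \<comment> \<open>This turns a condition on \<open>U'\<close> into an inclusion of
        \<open>U\<close> itself, which the enlarged family transfers to \<open>V\<close>; it then
        restricts to \<open>V'\<close>, which lies in \<open>\<Inter>C\<close>.\<close>
      then have "U \<subseteq> S \<union> - \<Inter>C" by (auto simp: U'_def)
      then have "U \<subseteq> T interior_of (S \<union> - \<Inter>C)" using oU by (simp add: interior_of_maximal)
      moreover have "T interior_of (S \<union> - \<Inter>C) \<in> ?D"
        using S by (auto simp: C_def intro!: image_eqI[where x = "(S, C)"])
      ultimately have "V \<subseteq> T interior_of (S \<union> - \<Inter>C)" using eq by blast
      then have "V \<subseteq> S \<union> - \<Inter>C" using interior_of_subset by (rule subset_trans)
      moreover have "V' \<subseteq> \<Inter>C" by (auto simp: C_def)
      ultimately show "V' \<subseteq> S" using xV' by blast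
    qed
    then have "sat M x U' \<phi> \<longleftrightarrow> sat M x V' \<phi>"
      using decidesD[OF D oU' V' xU'] xV' by blast
    moreover have "sat M x U' \<phi>"
      using sat oU' xU' by (simp add: U'_def)
    ultimately show "sat M x V' \<phi>" by blast
  qed
qed

text \<open>An atom depends on the point alone, negation keeps the family and conjunction unites
  two. The modal cases add finitely many interiors, indexed by subsets of \<open>D\<close>, so the
  family stays finite and open as the \<open>Box\<close> case requires.\<close>

lemma finite_open_decides:
  assumes M: "opens M = {U. openin T U}"
  shows "\<exists>D. finite D \<and> (\<forall>S \<in> D. openin T S) \<and> decides M D \<phi>"
proof (induction \<phi>)
  case (Atom a)
  show ?case by (rule exI[of _ "{}"]) (simp add: decides_def)
next
  case (And \<phi> \<psi>)
  then obtain D E where D: "finite D" "\<forall>S \<in> D. openin T S" "decides M D \<phi>"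
    and E: "finite E" "\<forall>S \<in> E. openin T S" "decides M E \<psi>" by blast
  have "decides M (D \<union> E) (And \<phi> \<psi>)"
  proof (rule decidesI)
    fix U V x
    assume "U \<in> opens M" "V \<in> opens M" "x \<in> U" "x \<in> V" "sat M x U (And \<phi> \<psi>)"
      and "\<forall>S \<in> D \<union> E. U \<subseteq> S \<longleftrightarrow> V \<subseteq> S"
    then show "sat M x V (And \<phi> \<psi>)"
      using decidesD[OF D(3), of U V x] decidesD[OF E(3), of U V x] by simp
  qed
  then show ?case using D E by (intro exI[of _ "D \<union> E"]) auto
next
  case (Neg \<phi>)
  have "decides M D (Neg \<phi>) \<longleftrightarrow> decides M D \<phi>" for D by (simp add: decides_def)
  then show ?case using Neg.IH by simp
next
  case (Box \<phi>)
  then obtain D where "finite D" "\<forall>S \<in> D. openin T S" "decides M D \<phi>" by blast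
  then show ?case
    by (intro exI[of _ "D \<union> (\<lambda>(S, C). T interior_of (S \<union> - \<Inter>C)) ` (D \<times> Pow D)"] conjI decides_Box[OF M])
      auto
next
  case (Know \<phi>)
  then obtain D where "finite D" "\<forall>S \<in> D. openin T S" "decides M D \<phi>" by blast
  note D = this
  show ?case
    by (rule exI, intro conjI, rule_tac [3] decides_Know[OF M D(3)]) (use D in auto)
qed

lemma basis_of_openin:
  assumes "basis_of T B" "U \<in> B"
  shows "openin T U"
  using assms by (simp add: basis_of_def arbitrary_union_of_inc)

lemma basis_of_point:
  assumes "basis_of T B" "openin T U" "x \<in> U"
  obtains V where "V \<in> B" "x \<in> V" "V \<subseteq> U"
proof -
  have "(arbitrary union_of (\<lambda>U. U \<in> B)) U" using assms by (simp add: basis_of_def)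
  then show thesis using assms(3) that unfolding union_of_def by blast
qed

text \<open>Closure under finite unions enters here: one basic neighbourhood inside \<open>U\<close>
  is chosen for each point of \<open>Y\<close>, and their union is basic. \<open>Y\<close> is
  nonempty because the empty union may fail to be basic.\<close>

lemma basis_of_finite_subset:
  assumes B: "basis_of T B" "closed_under_finite_unions B"
    and U: "openin T U" and Y: "finite Y" "Y \<noteq> {}" "Y \<subseteq> U"
  obtains V where "V \<in> B" "Y \<subseteq> V" "V \<subseteq> U"
proof -
  have "\<forall>y \<in> Y. \<exists>V. V \<in> B \<and> y \<in> V \<and> V \<subseteq> U"
    using basis_of_point[OF B(1) U] Y(3) by blast
  then obtain f where f: "\<And>y. y \<in> Y \<Longrightarrow> f y \<in> B \<and> y \<in> f y \<and> f y \<subseteq> U" by metis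
  have "\<Union>(f ` Y) \<in> B"
    using B(2) f Y unfolding closed_under_finite_unions_def
    by (metis finite_imageI image_is_empty image_subsetI)
  moreover have "Y \<subseteq> \<Union>(f ` Y)" "\<Union>(f ` Y) \<subseteq> U" using f by blast+
  ultimately show thesis by (rule that)
qed

lemma basic_sat_equiv:
  assumes B: "basis_of T B" "closed_under_finite_unions B"
    and M: "opens M = {U. openin T U}" and U: "openin T U" "x \<in> U"
  obtains V where "V \<in> B" "x \<in> V" "V \<subseteq> U" "sat M x V \<phi> \<longleftrightarrow> sat M x U \<phi>"
proof -
  obtain D where D: "finite D" "decides M D \<phi>"
    using finite_open_decides[OF M] by blast
  have "\<exists>y. \<not> U \<subseteq> S \<longrightarrow> y \<in> U - S" for S by blast
  then obtain w where w: "\<And>S. \<not> U \<subseteq> S \<Longrightarrow> w S \<in> U - S" by metis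
  let ?Y = "insert x (w ` {S \<in> D. \<not> U \<subseteq> S})"
  have "finite ?Y" "?Y \<noteq> {}" "?Y \<subseteq> U" using D(1) U(2) w by auto
  then obtain V where V: "V \<in> B" "?Y \<subseteq> V" "V \<subseteq> U"
    using basis_of_finite_subset[OF B U(1)] by blast
  \<comment> \<open>If \<open>U\<close> is not inside \<open>S\<close>, then \<open>V\<close>
    contains the point \<open>w S\<close> outside \<open>S\<close>; the converse is
    \<open>V \<subseteq> U\<close>.\<close>
  have "V \<subseteq> S \<longleftrightarrow> U \<subseteq> S" if "S \<in> D" for S
    using w[of S] V(2,3) that by blast
  then have "sat M x V \<phi> \<longleftrightarrow> sat M x U \<phi>"
    using decidesD[OF D(2), of V U x] M U V(2) basis_of_openin[OF B(1) V(1)] by simp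
  then show thesis using that V by blast
qed

text \<open>Only \<open>Box\<close> reads the family of opens. An open \<open>V\<close> missing from
  \<open>B\<close> is replaced by a basic \<open>V'\<close> inside it that agrees on
  \<open>\<phi>\<close> at \<open>x\<close>, so quantifying over \<open>B\<close> loses
  nothing.\<close>

lemma sat_basis_iff:
  assumes B: "basis_of T B" "closed_under_finite_unions B"
    and M: "opens M = {U. openin T U}" and N: "opens N = B" "interp N = interp M"
    and "U \<in> B" "x \<in> U"
  shows "sat M x U \<phi> \<longleftrightarrow> sat N x U \<phi>"
  using assms(6,7)
proof (induction \<phi> arbitrary: x U)
  case (Box \<phi>)
  have "(\<forall>V. openin T V \<and> x \<in> V \<and> V \<subseteq> U \<longrightarrow> sat M x V \<phi>)
    \<longleftrightarrow> (\<forall>V. V \<in> B \<and> x \<in> V \<and> V \<subseteq> U \<longrightarrow> sat M x V \<phi>)"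
  proof (intro iffI allI impI)
    fix V assume *: "\<forall>V. V \<in> B \<and> x \<in> V \<and> V \<subseteq> U \<longrightarrow> sat M x V \<phi>" and V: "openin T V \<and> x \<in> V \<and> V \<subseteq> U"
    obtain V' where "V' \<in> B" "x \<in> V'" "V' \<subseteq> V" "sat M x V' \<phi> \<longleftrightarrow> sat M x V \<phi>"
      using basic_sat_equiv[OF B M] V by blast
    then show "sat M x V \<phi>" using * V by blast
  qed (use basis_of_openin[OF B(1)] in blast)
  then show ?case using Box.IH M N(1) by auto
qed (use N in auto)

theorem theorem19:
  fixes T :: "'x topology"
    and B :: "'x set set"
    and tt ff :: "'p :: countable"
    and i :: "'p \<Rightarrow> 'x set"
    and M\<^sub>1 M\<^sub>2 :: "('x, 'p) model"
    and \<phi> :: "'p fm"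
  assumes "basis_of T B"
    and "closed_under_finite_unions B"
    and "topspace T \<in> B"
    and "tt \<noteq> ff"
    and "initial_interpretation tt ff (topspace T) i"
    and "M\<^sub>1 = \<lparr>points = topspace T, opens = {U. openin T U}, interp = i\<rparr>"
    and "M\<^sub>2 = \<lparr>points = topspace T, opens = B, interp = i\<rparr>"
  shows "valid_in M\<^sub>1 \<phi> \<longleftrightarrow> valid_in M\<^sub>2 \<phi>"
proof -
  have M1: "opens M\<^sub>1 = {U. openin T U}" and M2: "opens M\<^sub>2 = B" "interp M\<^sub>2 = interp M\<^sub>1"
    using assms(6,7) by auto
  \<comment> \<open>Validity is first restricted to basic sets within \<open>M\<^sub>1\<close>; only
    then is the model changed.\<close>
  have "valid_in M\<^sub>1 \<phi> \<longleftrightarrow> (\<forall>U \<in> B. \<forall>x \<in> U. sat M\<^sub>1 x U \<phi>)"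
    unfolding valid_in_def M1 mem_Collect_eq
  proof (intro iffI ballI; (elim CollectE)?)
    fix U x assume *: "\<forall>U \<in> B. \<forall>x \<in> U. sat M\<^sub>1 x U \<phi>" and U: "openin T U" "x \<in> U"
    obtain V where "V \<in> B" "x \<in> V" "sat M\<^sub>1 x V \<phi> \<longleftrightarrow> sat M\<^sub>1 x U \<phi>"
      using basic_sat_equiv[OF assms(1,2) M1 U] by blast
    then show "sat M\<^sub>1 x U \<phi>" using * by blast
  qed (use basis_of_openin[OF assms(1)] in blast)
  also have "\<dots> \<longleftrightarrow> valid_in M\<^sub>2 \<phi>"
    using sat_basis_iff[OF assms(1,2) M1 M2] by (simp add: valid_in_def M2)
  finally show ?thesis .
qed

end
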